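(* Let $H$ be a cancellative small category. Then $H$ is permutably factorial if and only if $H$ is atomic, $\omega_p'(H)=\omega_p(H)\le 1$, and every almost prime-like element of $H$ is prime-like.
   Context: A small category $H$ is identified with its set of morphisms (elements), with source $s(a)$ and target $t(a)$; $ab$ is defined iff $t(a)=s(b)$. $H^\times$ is the set of isomorphisms (units); $H$ is cancellative if $ab=ac$ or $ba=ca$ implies $b=c$. $a\simeq b$ (associated) if $b=\varepsilon a\eta$ with units $\varepsilon,\eta$. An atom is a non-unit $u$ such that $u=ab$ implies $a$ or $b$ is a unit; $\mathcal A(H)$ is the set of atoms; $H$ is atomic if every non-unit is a finite product of atoms. $H$ is permutably factorial if $H$ is atomic and, whenever $u_1\cdots u_k=v_1\cdots v_l$ with $k,l\in\mathbb N$ and atoms $u_i,v_j$, we have $k=l$ and there is a permutation $\sigma$ of $[1,k]$ with $u_i\simeq v_{\sigma(i)}$ for all $i$. For $a,b\in H$ write $a\mid_p b$ if there are $k,l\in\mathbb N_0$, units $\varepsilon,\eta$, atoms $u_1,\dots,u_k,v_1,\dots,v_l$ with $a=\varepsilon u_1\cdots u_k$, $b=\eta v_1\cdots v_l$, $k\le l$, and an injective map $\sigma:[1,k]\to[1,l]$ with $u_i\simeq v_{\sigma(i)}$ for all $i\in[1,k]$. A non-unit $q\in H$ is almost prime-like if $q\mid_p ab$ (with $t(a)=s(b)$) implies $q\mid_p a$ or $q\mid_p b$. If $H$ is atomic, almost prime-like elements are atoms. For an almost prime-like atom $q$ and $a\in H$, $\mathsf V_q(a)\subset\mathbb N_0$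 is the set of all $n$ such that there are $k\in\mathbb N_0$ and atoms $u_1,\dots,u_k$ with $a\simeq u_1\cdots u_k$ and $n=|\{i\in[1,k]:u_i\simeq q\}|$. An almost prime-like atom $q$ is prime-like if $|\mathsf V_q(a)|=1$ for all $a\in H$. Let $H$ be atomic and $a,b\in H$. $\omega_p'(a,b)$ is the smallest $N\in\mathbb N_0\cup\{\infty\}$ with the following property: for all $n\in\mathbb N$ and $a_1,\dots,a_n\in H$ with $a=a_1\cdots a_n$, if $b\mid_p a$, then there are $k\in[0,N]$ and an injective map $\sigma:[1,k]\to[1,n]$ such that the permuted subproduct $a_\sigma=a_{\sigma(1)}\cdots a_{\sigma(k)}$ is defined (an empty product being an identity) and $b\mid_p a_\sigma$. $\omega_p(a,b)$ is defined in the same way, but requiring the property only for factorizations $a=u_1\cdots u_n$ with all $u_i$ atoms. Set $\omega_p'(H,b)=\sup_{a\in H}\omega_p'(a,b)$, $\omega_p'(H)=\sup_{u\in\mathcal A(H)}\omega_p'(H,u)$, and similarly $\omega_p(H,b)$, $\omega_p(H)$; $\sup\emptyset=0$. *)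

theory Defs
  imports Main "HOL-Library.Extended_Nat" "HOL-Combinatorics.Permutations"
begin

text \<open>
  Composition is written in diagrammatic order: the product of \<open>a\<close> and \<open>b\<close> is meaningful
  iff the target of \<open>a\<close> is the source of \<open>b\<close>. The elements of the category are its morphisms,
  and outside composable pairs of morphisms the operation is unconstrained.
\<close>

record ('o, 'm) small_cat =
  Obj :: "'o set"
  Arr :: "'m set"
  src :: "'m \<Rightarrow> 'o"
  tgt :: "'m \<Rightarrow> 'o"
  ident :: "'o \<Rightarrow> 'm"
  cmp :: "'m \<Rightarrow> 'm \<Rightarrow> 'm" (infixl "\<cdot>\<index>" 70)

locale small_category =
  fixes H :: "('o, 'm) small_cat" (structure)
  assumes src_Obj: "a \<in> Arr H \<Longrightarrow> src H a \<in> Obj H"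
    and tgt_Obj: "a \<in> Arr H \<Longrightarrow> tgt H a \<in> Obj H"
    and ident_Arr: "x \<in> Obj H \<Longrightarrow> ident H x \<in> Arr H"
    and src_ident: "x \<in> Obj H \<Longrightarrow> src H (ident H x) = x"
    and tgt_ident: "x \<in> Obj H \<Longrightarrow> tgt H (ident H x) = x"
    and cmp_Arr: "\<lbrakk>a \<in> Arr H; b \<in> Arr H; tgt H a = src H b\<rbrakk> \<Longrightarrow> a \<cdot> b \<in> Arr H"
    and src_cmp: "\<lbrakk>a \<in> Arr H; b \<in> Arr H; tgt H a = src H b\<rbrakk> \<Longrightarrow> src H (a \<cdot> b) = src H a"
    and tgt_cmp: "\<lbrakk>a \<in> Arr H; b \<in> Arr H; tgt H a = src H b\<rbrakk> \<Longrightarrow> tgt H (a \<cdot> b) = tgt H b"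
    and ident_left: "a \<in> Arr H \<Longrightarrow> ident H (src H a) \<cdot> a = a"
    and ident_right: "a \<in> Arr H \<Longrightarrow> a \<cdot> ident H (tgt H a) = a"
    and cmp_assoc: "\<lbrakk>a \<in> Arr H; b \<in> Arr H; c \<in> Arr H; tgt H a = src H b; tgt H b = src H c\<rbrakk>
      \<Longrightarrow> (a \<cdot> b) \<cdot> c = a \<cdot> (b \<cdot> c)"

definition cancellative :: "('o, 'm) small_cat \<Rightarrow> bool" where
  "cancellative H \<longleftrightarrow> (\<forall>a\<in>Arr H. \<forall>b\<in>Arr H. \<forall>c\<in>Arr H.
     (tgt H a = src H b \<and> tgt H a = src H c \<and> a \<cdot>\<^bsub>H\<^esub> b = a \<cdot>\<^bsub>H\<^esub> c \<longrightarrow> b = c) \<and>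
     (tgt H b = src H a \<and> tgt H c = src H a \<and> b \<cdot>\<^bsub>H\<^esub> a = c \<cdot>\<^bsub>H\<^esub> a \<longrightarrow> b = c))"

definition isos :: "('o, 'm) small_cat \<Rightarrow> 'm set" where
  "isos H = {e \<in> Arr H. \<exists>d\<in>Arr H. tgt H e = src H d \<and> tgt H d = src H e \<and>
     e \<cdot>\<^bsub>H\<^esub> d = ident H (src H e) \<and> d \<cdot>\<^bsub>H\<^esub> e = ident H (tgt H e)}"

definition associated :: "('o, 'm) small_cat \<Rightarrow> 'm \<Rightarrow> 'm \<Rightarrow> bool" where
  "associated H a b \<longleftrightarrow> a \<in> Arr H \<and> b \<in> Arr H \<and>
     (\<exists>e\<in>isos H. \<exists>h\<in>isos H. tgt H e = src H a \<and> tgt H a = src H h \<and>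
        b = e \<cdot>\<^bsub>H\<^esub> a \<cdot>\<^bsub>H\<^esub> h)"

definition atoms :: "('o, 'm) small_cat \<Rightarrow> 'm set" where
  "atoms H = {u \<in> Arr H. u \<notin> isos H \<and>
     (\<forall>a\<in>Arr H. \<forall>b\<in>Arr H. tgt H a = src H b \<and> u = a \<cdot>\<^bsub>H\<^esub> b \<longrightarrow> a \<in> isos H \<or> b \<in> isos H)}"

text \<open>
  \<open>is_product H as a\<close>: the list \<open>as\<close> of elements is composable with product \<open>a\<close>.
  It is a relation because the empty list has every identity as a product.
\<close>

inductive is_product :: "('o, 'm) small_cat \<Rightarrow> 'm list \<Rightarrow> 'm \<Rightarrow> bool" for H where
  Nil: "x \<in> Obj H \<Longrightarrow> is_product H [] (ident H x)"
| Cons: "\<lbrakk>u \<in> Arr H; is_product H us a; tgt H u = src H a\<rbrakk> \<Longrightarrow> is_product H (u # us) (u \<cdot>\<^bsub>H\<^esub> a)"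

definition atomic :: "('o, 'm) small_cat \<Rightarrow> bool" where
  "atomic H \<longleftrightarrow> (\<forall>a\<in>Arr H - isos H. \<exists>us. set us \<subseteq> atoms H \<and> is_product H us a)"

definition permutably_factorial :: "('o, 'm) small_cat \<Rightarrow> bool" where
  "permutably_factorial H \<longleftrightarrow> atomic H \<and>
     (\<forall>us vs a. us \<noteq> [] \<and> vs \<noteq> [] \<and> set us \<subseteq> atoms H \<and> set vs \<subseteq> atoms H \<and>
        is_product H us a \<and> is_product H vs a \<longrightarrow>
        length us = length vs \<and>
        (\<exists>\<sigma>. \<sigma> permutes {..<length us} \<and> (\<forall>i<length us. associated H (us ! i) (vs ! \<sigma> i))))"

definition pdvd :: "('o, 'm) small_cat \<Rightarrow> 'm \<Rightarrow> 'm \<Rightarrow> bool" where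
  "pdvd H a b \<longleftrightarrow> (\<exists>e\<in>isos H. \<exists>h\<in>isos H. \<exists>us vs a' b' \<sigma>.
     set us \<subseteq> atoms H \<and> is_product H us a' \<and> tgt H e = src H a' \<and> a = e \<cdot>\<^bsub>H\<^esub> a' \<and>
     set vs \<subseteq> atoms H \<and> is_product H vs b' \<and> tgt H h = src H b' \<and> b = h \<cdot>\<^bsub>H\<^esub> b' \<and>
     length us \<le> length vs \<and>
     inj_on \<sigma> {..<length us} \<and> \<sigma> ` {..<length us} \<subseteq> {..<length vs} \<and>
     (\<forall>i<length us. associated H (us ! i) (vs ! \<sigma> i)))"

definition almost_prime_like :: "('o, 'm) small_cat \<Rightarrow> 'm \<Rightarrow> bool" where
  "almost_prime_like H q \<longleftrightarrow> q \<in> Arr H \<and> q \<notin> isos H \<and>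
     (\<forall>a\<in>Arr H. \<forall>b\<in>Arr H. tgt H a = src H b \<and> pdvd H q (a \<cdot>\<^bsub>H\<^esub> b) \<longrightarrow> pdvd H q a \<or> pdvd H q b)"

definition V_values :: "('o, 'm) small_cat \<Rightarrow> 'm \<Rightarrow> 'm \<Rightarrow> nat set" where
  "V_values H q a = {n. \<exists>us a'. set us \<subseteq> atoms H \<and> is_product H us a' \<and> associated H a a' \<and>
     n = card {i. i < length us \<and> associated H (us ! i) q}}"

definition prime_like :: "('o, 'm) small_cat \<Rightarrow> 'm \<Rightarrow> bool" where
  "prime_like H q \<longleftrightarrow> almost_prime_like H q \<and> q \<in> atoms H \<and> (\<forall>a\<in>Arr H. card (V_values H q a) = 1)"

text \<open>
  The property whose least \<open>N\<close> defines the omega-invariants, with factors taken from the set \<open>A\<close>: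
  all elements for the primed invariants and all atoms for the unprimed ones. It always holds
  for \<open>N = \<infinity>\<close> (take all factors in their given order).
\<close>

definition omega_bound :: "('o, 'm) small_cat \<Rightarrow> 'm set \<Rightarrow> 'm \<Rightarrow> 'm \<Rightarrow> enat \<Rightarrow> bool" where
  "omega_bound H A a b N \<longleftrightarrow>
     (\<forall>as. as \<noteq> [] \<and> set as \<subseteq> A \<and> is_product H as a \<and> pdvd H b a \<longrightarrow>
        (\<exists>k \<sigma> c. enat k \<le> N \<and> inj_on \<sigma> {..<k} \<and> \<sigma> ` {..<k} \<subseteq> {..<length as} \<and>
           is_product H (map (\<lambda>i. as ! \<sigma> i) [0..<k]) c \<and> pdvd H b c))"

definition omega_p'_at :: "('o, 'm) small_cat \<Rightarrow> 'm \<Rightarrow> 'm \<Rightarrow> enat" where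
  "omega_p'_at H a b = (LEAST N. omega_bound H (Arr H) a b N)"

definition omega_p_at :: "('o, 'm) small_cat \<Rightarrow> 'm \<Rightarrow> 'm \<Rightarrow> enat" where
  "omega_p_at H a b = (LEAST N. omega_bound H (atoms H) a b N)"

definition omega_p'_elt :: "('o, 'm) small_cat \<Rightarrow> 'm \<Rightarrow> enat" where
  "omega_p'_elt H b = (SUP a\<in>Arr H. omega_p'_at H a b)"

definition omega_p_elt :: "('o, 'm) small_cat \<Rightarrow> 'm \<Rightarrow> enat" where
  "omega_p_elt H b = (SUP a\<in>Arr H. omega_p_at H a b)"

definition omega_p' :: "('o, 'm) small_cat \<Rightarrow> enat" where
  "omega_p' H = (SUP u\<in>atoms H. omega_p'_elt H u)"

definition omega_p :: "('o, 'm) small_cat \<Rightarrow> enat" where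
  "omega_p H = (SUP u\<in>atoms H. omega_p_elt H u)"

end

theory Submission
  imports Defs
begin

text \<open>
  Record a factorization \<open>a = e u\<^sub>1 \<dots> u\<^sub>k\<close> with a leading unit \<open>e\<close> by the multiset of the
  association classes of its atoms. Units can be moved across atoms without changing their
  classes, so these multisets add up under composition. In this language \<open>H\<close> is permutably
  factorial iff it is atomic and every element has at most one such multiset, \<open>a\<close> divides \<open>b\<close> up
  to permutation iff some multiset of \<open>a\<close> is contained in one of \<open>b\<close>, and the values of
  \<open>V\<^sub>q(a)\<close> are the multiplicities of the class of \<open>q\<close> in the multisets of \<open>a\<close>.

  The bound \<open>\<omega>\<^sub>p' \<le> 1\<close> on products of two factors says that every atom is almost prime-like; if
  all of them are prime-like, the multiset of an element is determined multiplicity by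
  multiplicity. Conversely, if multisets are unique, an atom occurring in a product occurs in one
  of its factors, which bounds both invariants by 1; and every value set \<open>V\<^sub>q(a)\<close> is a singleton.
  The two invariants agree because each vanishes exactly when there are no
  atoms, as an atom does not divide an empty product.
\<close>

definition assoc_class :: "('o, 'm) small_cat \<Rightarrow> 'm \<Rightarrow> 'm set" where
  "assoc_class H u = {v. associated H v u}"

text \<open>The only products of the empty list are identities, so without the leading unit the
  other units would receive no multiset at all.\<close>

definition factors_as :: "('o, 'm) small_cat \<Rightarrow> 'm \<Rightarrow> 'm set multiset \<Rightarrow> bool" where
  "factors_as H a M \<longleftrightarrow> (\<exists>e\<in>isos H. \<exists>us a'. set us \<subseteq> atoms H \<and> is_product H us a' \<and>
     tgt H e = src H a' \<and> a = e \<cdot>\<^bsub>H\<^esub> a' \<and> M = mset (map (assoc_class H) us))"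

context small_category
begin

section \<open>Units and their inverses\<close>

lemmas category_simps [simp] = src_Obj tgt_Obj ident_Arr src_ident tgt_ident cmp_Arr src_cmp
  tgt_cmp ident_left ident_right cmp_assoc

text \<open>The object is kept apart from \<open>src H a\<close>, so the simplifier can remove
  identities whose object is only provably the source; likewise on the right.\<close>

lemma ident_left' [simp]: "\<lbrakk>a \<in> Arr H; src H a = x\<rbrakk> \<Longrightarrow> ident H x \<cdot> a = a"
  using ident_left by blast

lemma ident_right' [simp]: "\<lbrakk>a \<in> Arr H; tgt H a = x\<rbrakk> \<Longrightarrow> a \<cdot> ident H x = a"
  using ident_right by blast

lemma isos_Arr [simp]: "e \<in> isos H \<Longrightarrow> e \<in> Arr H"
  by (simp add: isos_def)

lemma atoms_Arr [simp]: "u \<in> atoms H \<Longrightarrow> u \<in> Arr H"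
  unfolding atoms_def by blast

lemma atoms_not_isos [simp]: "u \<in> atoms H \<Longrightarrow> u \<notin> isos H"
  unfolding atoms_def by blast

lemma atoms_cmpD:
  "\<lbrakk>a \<cdot> b \<in> atoms H; a \<in> Arr H; b \<in> Arr H; tgt H a = src H b\<rbrakk> \<Longrightarrow> a \<in> isos H \<or> b \<in> isos H"
  unfolding atoms_def by blast

lemma ident_isos [simp]: "x \<in> Obj H \<Longrightarrow> ident H x \<in> isos H"
  unfolding isos_def by (auto intro!: bexI [of _ "ident H x"])

text \<open>The last two facts cancel an inverse inside a longer product. They are nested to the
  right because \<open>cmp_assoc\<close> rewrites every product into that form.\<close>

lemma isosE:
  assumes "e \<in> isos H"
  obtains d where "d \<in> isos H" "tgt H e = src H d" "tgt H d = src H e"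
    "e \<cdot> d = ident H (src H e)" "d \<cdot> e = ident H (tgt H e)"
    "\<And>x. x \<in> Arr H \<Longrightarrow> src H x = src H e \<Longrightarrow> e \<cdot> (d \<cdot> x) = x"
    "\<And>x. x \<in> Arr H \<Longrightarrow> src H x = src H d \<Longrightarrow> d \<cdot> (e \<cdot> x) = x"
proof -
  obtain d where e: "e \<in> Arr H" and d: "d \<in> Arr H" "tgt H e = src H d" "tgt H d = src H e"
    "e \<cdot> d = ident H (src H e)" "d \<cdot> e = ident H (tgt H e)"
    using assms unfolding isos_def by auto
  have "d \<in> isos H"
    unfolding isos_def using d e by auto
  moreover have "e \<cdot> (d \<cdot> x) = x" if "x \<in> Arr H" "src H x = src H e" for x
    using cmp_assoc [of e d x] that d e by simp
  moreover have "d \<cdot> (e \<cdot> x) = x" if "x \<in> Arr H" "src H x = src H d" for x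
    using cmp_assoc [of d e x] that d e by simp
  ultimately show thesis
    using that d by blast
qed

lemma isos_cmp [simp]:
  assumes "e \<in> isos H" "f \<in> isos H" "tgt H e = src H f"
  shows "e \<cdot> f \<in> isos H"
proof -
  obtain e' where e': "e' \<in> isos H" "tgt H e = src H e'" "tgt H e' = src H e"
    "e \<cdot> e' = ident H (src H e)" "e' \<cdot> e = ident H (tgt H e)"
    "\<And>x. x \<in> Arr H \<Longrightarrow> src H x = src H e' \<Longrightarrow> e' \<cdot> (e \<cdot> x) = x"
    using isosE [OF assms(1)] by metis
  obtain f' where f': "f' \<in> isos H" "tgt H f = src H f'" "tgt H f' = src H f"
    "f \<cdot> f' = ident H (src H f)" "f' \<cdot> f = ident H (tgt H f)"
    "\<And>x. x \<in> Arr H \<Longrightarrow> src H x = src H f \<Longrightarrow> f \<cdot> (f' \<cdot> x) = x"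
    using isosE [OF assms(2)] by metis
  show ?thesis
    unfolding isos_def using assms e' f' by (auto intro!: bexI [of _ "f' \<cdot> e'"])
qed

lemma isos_cmp_left_iff:
  assumes "e \<in> isos H" "a \<in> Arr H" "tgt H e = src H a"
  shows "e \<cdot> a \<in> isos H \<longleftrightarrow> a \<in> isos H"
proof
  assume *: "e \<cdot> a \<in> isos H"
  obtain d where d: "d \<in> isos H" "tgt H e = src H d" "tgt H d = src H e"
    "\<And>x. x \<in> Arr H \<Longrightarrow> src H x = src H d \<Longrightarrow> d \<cdot> (e \<cdot> x) = x"
    using isosE [OF assms(1)] by metis
  have "d \<cdot> (e \<cdot> a) \<in> isos H"
    by (rule isos_cmp) (use * d assms in auto)
  moreover have "d \<cdot> (e \<cdot> a) = a" using d assms by simp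
  ultimately show "a \<in> isos H" by metis
qed (use assms in simp)

lemma isos_cmp_right_iff:
  assumes "e \<in> isos H" "a \<in> Arr H" "tgt H a = src H e"
  shows "a \<cdot> e \<in> isos H \<longleftrightarrow> a \<in> isos H"
proof
  assume *: "a \<cdot> e \<in> isos H"
  obtain d where d: "d \<in> isos H" "tgt H e = src H d" "tgt H d = src H e"
    "e \<cdot> d = ident H (src H e)"
    using isosE [OF assms(1)] by metis
  have "(a \<cdot> e) \<cdot> d \<in> isos H"
    by (rule isos_cmp) (use * d assms in auto)
  moreover have "(a \<cdot> e) \<cdot> d = a" using d assms by simp
  ultimately show "a \<in> isos H" by metis
qed (use assms in simp)

section \<open>Association and its classes\<close>

lemma associatedI:
  "\<lbrakk>a \<in> Arr H; e \<in> isos H; h \<in> isos H; tgt H e = src H a; tgt H a = src H h; b = e \<cdot> a \<cdot> h\<rbrakk>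
    \<Longrightarrow> associated H a b"
  unfolding associated_def by (intro conjI bexI [of _ e] bexI [of _ h]) auto

lemma associated_refl: "a \<in> Arr H \<Longrightarrow> associated H a a"
  by (rule associatedI [of _ "ident H (src H a)" "ident H (tgt H a)"]) auto

lemma associated_cmp_left:
  "\<lbrakk>a \<in> Arr H; e \<in> isos H; tgt H e = src H a\<rbrakk> \<Longrightarrow> associated H a (e \<cdot> a)"
  by (rule associatedI [of _ e "ident H (tgt H a)"]) auto

lemma associated_cmp_right:
  "\<lbrakk>a \<in> Arr H; e \<in> isos H; tgt H a = src H e\<rbrakk> \<Longrightarrow> associated H a (a \<cdot> e)"
  by (rule associatedI [of _ "ident H (src H a)" e]) auto

lemma associated_sym:
  assumes "associated H a b"
  shows "associated H b a"
proof -
  obtain e h where eh: "a \<in> Arr H" "b \<in> Arr H" "e \<in> isos H" "h \<in> isos H"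
    "tgt H e = src H a" "tgt H a = src H h" "b = e \<cdot> a \<cdot> h"
    using assms unfolding associated_def by auto
  obtain e' where e': "e' \<in> isos H" "tgt H e = src H e'" "tgt H e' = src H e"
    "\<And>x. x \<in> Arr H \<Longrightarrow> src H x = src H e' \<Longrightarrow> e' \<cdot> (e \<cdot> x) = x"
    using isosE [OF eh(3)] by metis
  obtain h' where h': "h' \<in> isos H" "tgt H h = src H h'" "tgt H h' = src H h"
    "h \<cdot> h' = ident H (src H h)"
    using isosE [OF eh(4)] by metis
  show ?thesis
    by (rule associatedI [of _ e' h']) (use eh e' h' in auto)
qed

lemma associated_trans:
  assumes "associated H a b" "associated H b c"
  shows "associated H a c"
proof -
  obtain e h where eh: "a \<in> Arr H" "e \<in> isos H" "h \<in> isos H"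
    "tgt H e = src H a" "tgt H a = src H h" "b = e \<cdot> a \<cdot> h"
    using assms(1) unfolding associated_def by auto
  obtain e' h' where eh': "e' \<in> isos H" "h' \<in> isos H"
    "tgt H e' = src H b" "tgt H b = src H h'" "c = e' \<cdot> b \<cdot> h'"
    using assms(2) unfolding associated_def by auto
  show ?thesis
    by (rule associatedI [of _ "e' \<cdot> e" "h \<cdot> h'"]) (use eh eh' in auto)
qed

text \<open>An arrow lies in its own class, so equality of the classes puts \<open>u\<close> into
  the class of \<open>v\<close>; the converse is symmetry and transitivity.\<close>

lemma assoc_class_eq_iff:
  assumes "u \<in> Arr H"
  shows "assoc_class H u = assoc_class H v \<longleftrightarrow> associated H u v"
  using assms associated_refl associated_sym associated_trans unfolding assoc_class_def by blast

lemma assoc_class_eqI: "associated H u v \<Longrightarrow> assoc_class H u = assoc_class H v"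
  using assoc_class_eq_iff by (auto simp: associated_def)

lemma assoc_class_eqD: "assoc_class H u = assoc_class H v \<Longrightarrow> u \<in> Arr H \<Longrightarrow> associated H u v"
  using assoc_class_eq_iff by blast

lemma assoc_class_cmp_left [simp]:
  "\<lbrakk>a \<in> Arr H; e \<in> isos H; tgt H e = src H a\<rbrakk> \<Longrightarrow> assoc_class H (e \<cdot> a) = assoc_class H a"
  using associated_cmp_left assoc_class_eq_iff by metis

lemma assoc_class_cmp_right [simp]:
  "\<lbrakk>a \<in> Arr H; e \<in> isos H; tgt H a = src H e\<rbrakk> \<Longrightarrow> assoc_class H (a \<cdot> e) = assoc_class H a"
  using associated_cmp_right assoc_class_eq_iff by metis

text \<open>With \<open>d\<close> inverse to \<open>e\<close>, a splitting
  \<open>e \<cdot> u = a \<cdot> b\<close> becomes the splitting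
  \<open>u = (d \<cdot> a) \<cdot> b\<close> of the atom, and \<open>d \<cdot> a\<close> is a unit
  only if \<open>a\<close> is.\<close>

lemma atoms_cmp_left:
  assumes u: "u \<in> atoms H" and e: "e \<in> isos H" "tgt H e = src H u"
  shows "e \<cdot> u \<in> atoms H"
  unfolding atoms_def
proof (intro CollectI conjI ballI impI; (elim conjE)?)
  show "e \<cdot> u \<in> Arr H" "e \<cdot> u \<notin> isos H"
    using u e isos_cmp_left_iff [of e u] by simp_all
  fix a b assume ab: "a \<in> Arr H" "b \<in> Arr H" "tgt H a = src H b" "e \<cdot> u = a \<cdot> b"
  obtain d where d: "d \<in> isos H" "tgt H e = src H d" "tgt H d = src H e"
    "\<And>x. x \<in> Arr H \<Longrightarrow> src H x = src H d \<Longrightarrow> d \<cdot> (e \<cdot> x) = x"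
    using isosE [OF e(1)] by metis
  have "src H a = src H (e \<cdot> u)" using ab by simp
  then have src: "tgt H d = src H a" using u e d by simp
  have "u = d \<cdot> (e \<cdot> u)" using u e d by simp
  also have "\<dots> = (d \<cdot> a) \<cdot> b" using ab d src by simp
  finally have "u = (d \<cdot> a) \<cdot> b" .
  moreover have "d \<cdot> a \<in> Arr H" "tgt H (d \<cdot> a) = src H b" using ab d src by simp_all
  ultimately have "d \<cdot> a \<in> isos H \<or> b \<in> isos H"
    using u ab atoms_cmpD by blast
  then show "a \<in> isos H \<or> b \<in> isos H"
    using isos_cmp_left_iff [of d a] d ab src by simp
qed

lemma atoms_cmp_right:
  assumes u: "u \<in> atoms H" and e: "e \<in> isos H" "tgt H u = src H e"
  shows "u \<cdot> e \<in> atoms H"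
  unfolding atoms_def
proof (intro CollectI conjI ballI impI; (elim conjE)?)
  show "u \<cdot> e \<in> Arr H" "u \<cdot> e \<notin> isos H"
    using u e isos_cmp_right_iff [of e u] by simp_all
  fix a b assume ab: "a \<in> Arr H" "b \<in> Arr H" "tgt H a = src H b" "u \<cdot> e = a \<cdot> b"
  obtain d where d: "d \<in> isos H" "tgt H e = src H d" "tgt H d = src H e"
    "e \<cdot> d = ident H (src H e)"
    using isosE [OF e(1)] by metis
  have "tgt H b = tgt H (u \<cdot> e)" using ab by simp
  then have tgt: "tgt H b = src H d" using u e d by simp
  have "u = (u \<cdot> e) \<cdot> d" using u e d by simp
  also have "\<dots> = a \<cdot> (b \<cdot> d)" using ab d tgt by simp
  finally have "u = a \<cdot> (b \<cdot> d)" .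
  moreover have "b \<cdot> d \<in> Arr H" "tgt H a = src H (b \<cdot> d)" using ab d tgt by simp_all
  ultimately have "a \<in> isos H \<or> b \<cdot> d \<in> isos H"
    using u ab atoms_cmpD by blast
  then show "a \<in> isos H \<or> b \<in> isos H"
    using isos_cmp_right_iff [of d b] d ab tgt by simp
qed

section \<open>Products of lists and multisets of atom classes\<close>

lemma is_product_Arr: "is_product H us a \<Longrightarrow> a \<in> Arr H"
  by (induction rule: is_product.induct) auto

lemma is_product_set: "is_product H us a \<Longrightarrow> set us \<subseteq> Arr H"
  by (induction rule: is_product.induct) auto

lemma is_product_Nil_iff: "is_product H [] a \<longleftrightarrow> (\<exists>x\<in>Obj H. a = ident H x)"
  by (auto intro: is_product.intros elim: is_product.cases)

lemma is_product_Cons_iff: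
  "is_product H (u # us) a \<longleftrightarrow>
     (\<exists>b. u \<in> Arr H \<and> is_product H us b \<and> tgt H u = src H b \<and> a = u \<cdot> b)"
  by (auto intro: is_product.intros elim: is_product.cases)

lemma is_product_single_iff: "is_product H [u] a \<longleftrightarrow> u \<in> Arr H \<and> a = u"
  by (auto simp: is_product_Cons_iff is_product_Nil_iff) (metis ident_right tgt_Obj src_ident)

lemma factors_asI:
  "\<lbrakk>set us \<subseteq> atoms H; is_product H us a\<rbrakk> \<Longrightarrow> factors_as H a (mset (map (assoc_class H) us))"
  unfolding factors_as_def using is_product_Arr [of us a]
  by (intro bexI [of _ "ident H (src H a)"] exI [of _ us] exI [of _ a]) auto

lemma factors_as_Arr: "factors_as H a M \<Longrightarrow> a \<in> Arr H"
  unfolding factors_as_def using is_product_Arr by auto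

lemma factors_as_atom: "u \<in> atoms H \<Longrightarrow> factors_as H u {#assoc_class H u#}"
  using factors_asI [of "[u]" u] by (simp add: is_product_single_iff)

lemma factors_as_iso: "e \<in> isos H \<Longrightarrow> factors_as H e {#}"
  unfolding factors_as_def
  by (intro bexI [of _ e] exI [of _ "[]"] exI [of _ "ident H (tgt H e)"])
    (auto simp: is_product_Nil_iff)

lemma factors_as_cmp_left:
  assumes "factors_as H a M" "e \<in> isos H" "tgt H e = src H a"
  shows "factors_as H (e \<cdot> a) M"
proof -
  obtain d us a' where *: "d \<in> isos H" "set us \<subseteq> atoms H" "is_product H us a'"
    "tgt H d = src H a'" "a = d \<cdot> a'" "M = mset (map (assoc_class H) us)"
    using assms(1) unfolding factors_as_def by blast
  have "a' \<in> Arr H" using is_product_Arr * by blast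
  then show ?thesis
    unfolding factors_as_def using * assms
    by (intro bexI [of _ "e \<cdot> d"] exI [of _ us] exI [of _ a']) auto
qed

text \<open>The leading unit \<open>e\<close> of \<open>a\<close> ends up between \<open>u\<close>
  and the atoms of \<open>a\<close>. It is absorbed into \<open>u\<close>, giving the atom
  \<open>u \<cdot> e\<close> of the same class.\<close>

lemma factors_as_atom_cmp:
  assumes "factors_as H a M" "u \<in> atoms H" "tgt H u = src H a"
  shows "factors_as H (u \<cdot> a) (add_mset (assoc_class H u) M)"
proof -
  obtain e us a' where *: "e \<in> isos H" "set us \<subseteq> atoms H" "is_product H us a'"
    "tgt H e = src H a'" "a = e \<cdot> a'" "M = mset (map (assoc_class H) us)"
    using assms(1) unfolding factors_as_def by blast
  have a': "a' \<in> Arr H" using is_product_Arr * by blast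
  have ue: "u \<cdot> e \<in> atoms H"
    using atoms_cmp_right assms * a' by simp
  have "is_product H ((u \<cdot> e) # us) (u \<cdot> a)"
    unfolding is_product_Cons_iff using assms * a' by (intro exI [of _ a']) auto
  then have "factors_as H (u \<cdot> a) (mset (map (assoc_class H) ((u \<cdot> e) # us)))"
    using ue * by (intro factors_asI) auto
  then show ?thesis using assms * a' by simp
qed

lemma factors_as_cmp:
  assumes "factors_as H a M" "factors_as H b N" "tgt H a = src H b"
  shows "factors_as H (a \<cdot> b) (M + N)"
proof -
  \<comment> \<open>Induction over the atoms of the first factor, without its leading unit; that
    unit is put back at the end by \<open>factors_as_cmp_left\<close>.\<close>
  have prod: "factors_as H (c \<cdot> b) (mset (map (assoc_class H) us) + N)"
    if "set us \<subseteq> atoms H" "is_product H us c" "tgt H c = src H b" for us c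
    using that(2,1,3)
  proof (induction rule: is_product.induct)
    case (Nil x)
    then show ?case using assms(2) factors_as_Arr [OF assms(2)] by simp
  next
    case (Cons u us c)
    then have c: "c \<in> Arr H" "b \<in> Arr H"
      using is_product_Arr factors_as_Arr [OF assms(2)] by auto
    then have "factors_as H (u \<cdot> (c \<cdot> b))
        (add_mset (assoc_class H u) (mset (map (assoc_class H) us) + N))"
      using Cons by (intro factors_as_atom_cmp) auto
    then show ?case using Cons c by simp
  qed
  obtain e us a' where *: "e \<in> isos H" "set us \<subseteq> atoms H" "is_product H us a'"
    "tgt H e = src H a'" "a = e \<cdot> a'" "M = mset (map (assoc_class H) us)"
    using assms(1) unfolding factors_as_def by blast
  have "a' \<in> Arr H" "b \<in> Arr H" using is_product_Arr * factors_as_Arr assms by blast+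
  moreover then have "factors_as H (e \<cdot> (a' \<cdot> b)) (M + N)"
    using prod [of us a'] * assms by (intro factors_as_cmp_left [of "a' \<cdot> b"]) auto
  ultimately show ?thesis using * assms by simp
qed

lemma factors_as_cong_associated:
  assumes "associated H a b"
  shows "factors_as H a M \<longleftrightarrow> factors_as H b M"
proof -
  have "factors_as H b M" if ass: "associated H a b" and f: "factors_as H a M" for a b
  proof -
    obtain e h where eh: "a \<in> Arr H" "b \<in> Arr H" "e \<in> isos H" "h \<in> isos H"
      "tgt H e = src H a" "tgt H a = src H h" "b = e \<cdot> a \<cdot> h"
      using ass unfolding associated_def by auto
    have "factors_as H (e \<cdot> a) M"
      using factors_as_cmp_left f eh by simp
    \<comment> \<open>The trailing unit \<open>h\<close> is treated as a second factor with empty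
      multiset.\<close>
    then have "factors_as H (e \<cdot> a \<cdot> h) (M + {#})"
      using eh by (intro factors_as_cmp factors_as_iso) auto
    then show ?thesis using eh by simp
  qed
  then show ?thesis using assms associated_sym by blast
qed

lemma factors_as_exists:
  assumes "atomic H" "a \<in> Arr H"
  obtains M where "factors_as H a M"
proof (cases "a \<in> isos H")
  case True
  then show ?thesis using that factors_as_iso by blast
next
  case False
  then obtain us where "set us \<subseteq> atoms H" "is_product H us a"
    using assms unfolding atomic_def by blast
  then show ?thesis using that factors_asI by blast
qed

text \<open>Lets a comparison of multiplicities be restricted to classes of atoms.\<close>

lemma factors_as_classes:
  "\<lbrakk>factors_as H a M; C \<in># M\<rbrakk> \<Longrightarrow> \<exists>q\<in>atoms H. C = assoc_class H q"
  unfolding factors_as_def by (auto 0 3)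

text \<open>The leading unit can be absorbed into the first atom, provided there is one.\<close>

lemma factors_as_nonempty:
  assumes "factors_as H a M" "M \<noteq> {#}"
  obtains us where "us \<noteq> []" "set us \<subseteq> atoms H" "is_product H us a"
    "M = mset (map (assoc_class H) us)"
proof -
  obtain e us a' where *: "e \<in> isos H" "set us \<subseteq> atoms H" "is_product H us a'"
    "tgt H e = src H a'" "a = e \<cdot> a'" "M = mset (map (assoc_class H) us)"
    using assms(1) unfolding factors_as_def by blast
  then obtain u vs where us: "us = u # vs" using assms(2) by (cases us) auto
  obtain b where b: "u \<in> Arr H" "is_product H vs b" "tgt H u = src H b" "a' = u \<cdot> b"
    using * us by (auto simp: is_product_Cons_iff)
  have b': "b \<in> Arr H" using is_product_Arr b by blast
  have "is_product H ((e \<cdot> u) # vs) a"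
    unfolding is_product_Cons_iff using * b b' by (intro exI [of _ b]) auto
  moreover have "e \<cdot> u \<in> atoms H"
    using atoms_cmp_left [of u e] * us b b' by simp
  ultimately show thesis
    using that [of "(e \<cdot> u) # vs"] * us b b' by auto
qed

text \<open>\<open>V_values\<close> allows units on both sides of the product,
  \<open>factors_as\<close> only in front. Both see the same multisets, since these are invariant
  under association.\<close>

lemma V_values_eq:
  assumes "q \<in> Arr H"
  shows "V_values H q a = (\<lambda>M. count M (assoc_class H q)) ` {M. factors_as H a M}"
proof -
  have card: "card {i. i < length us \<and> associated H (us ! i) q} =
      count (mset (map (assoc_class H) us)) (assoc_class H q)" if "set us \<subseteq> atoms H" for us
  proof -
    have "count (mset (map (assoc_class H) us)) (assoc_class H q) =
        length (filter (\<lambda>u. assoc_class H u = assoc_class H q) us)"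
      by (induction us) auto
    also have "\<dots> = length (filter (\<lambda>u. associated H u q) us)"
      by (intro arg_cong [of _ _ length] filter_cong refl assoc_class_eq_iff) (use that in auto)
    finally show ?thesis by (simp add: length_filter_conv_card)
  qed
  show ?thesis
  proof (intro set_eqI iffI)
    fix n assume "n \<in> V_values H q a"
    then obtain us a' where us: "set us \<subseteq> atoms H" "is_product H us a'" "associated H a a'"
      "n = card {i. i < length us \<and> associated H (us ! i) q}"
      unfolding V_values_def by blast
    then have "factors_as H a (mset (map (assoc_class H) us))"
      using factors_asI factors_as_cong_associated by blast
    then show "n \<in> (\<lambda>M. count M (assoc_class H q)) ` {M. factors_as H a M}"
      using us card by auto
  next
    fix n assume "n \<in> (\<lambda>M. count M (assoc_class H q)) ` {M. factors_as H a M}"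
    then obtain M where M: "factors_as H a M" "n = count M (assoc_class H q)" by auto
    then obtain e us a' where *: "e \<in> isos H" "set us \<subseteq> atoms H" "is_product H us a'"
      "tgt H e = src H a'" "a = e \<cdot> a'" "M = mset (map (assoc_class H) us)"
      unfolding factors_as_def by blast
    have "associated H a a'"
      using associated_sym associated_cmp_left is_product_Arr * by simp
    then show "n \<in> V_values H q a"
      unfolding V_values_def using * M card by force
  qed
qed

text \<open>An injective matching of associated atoms is the same as an inclusion of the multisets
  of their classes.\<close>

lemma pdvd_iff:
  "pdvd H a b \<longleftrightarrow> (\<exists>M N. factors_as H a M \<and> factors_as H b N \<and> M \<subseteq># N)"
proof
  assume "pdvd H a b"
  then show "\<exists>M N. factors_as H a M \<and> factors_as H b N \<and> M \<subseteq># N"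
    unfolding pdvd_def
  proof (elim bexE exE conjE)
    fix e h us vs a' b' \<sigma> assume *: "e \<in> isos H" "h \<in> isos H"
       "set us \<subseteq> atoms H" "is_product H us a'" "tgt H e = src H a'" "a = e \<cdot> a'"
       "set vs \<subseteq> atoms H" "is_product H vs b'" "tgt H h = src H b'" "b = h \<cdot> b'"
       and \<sigma>: "inj_on \<sigma> {..<length us}" "\<sigma> ` {..<length us} \<subseteq> {..<length vs}"
       "\<forall>i<length us. associated H (us ! i) (vs ! \<sigma> i)"
    \<comment> \<open>Writing the class multiset as an image of the index set makes it possible to
      transport it along \<open>\<sigma>\<close>.\<close>
    have idx: "mset (map (assoc_class H) ws) =
        image_mset (\<lambda>i. assoc_class H (ws ! i)) (mset_set {..<length ws})" for ws
    proof -
      have "map (assoc_class H) ws = map (\<lambda>i. assoc_class H (ws ! i)) [0..<length ws]"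
        by (rule nth_equalityI) auto
      then show ?thesis
        by (metis mset_map mset_upt atLeast0LessThan)
    qed
    have cls: "assoc_class H (us ! i) = assoc_class H (vs ! \<sigma> i)" if "i < length us" for i
      using that \<sigma>(3) assoc_class_eqI by blast
    have "mset (map (assoc_class H) us) =
        image_mset (\<lambda>i. assoc_class H (vs ! \<sigma> i)) (mset_set {..<length us})"
      unfolding idx using cls by (intro image_mset_cong) auto
    \<comment> \<open>Injectivity of \<open>\<sigma>\<close> ensures that no index of the image is
      counted twice.\<close>
    also have "\<dots> = image_mset (\<lambda>i. assoc_class H (vs ! i)) (mset_set (\<sigma> ` {..<length us}))"
      using \<sigma>(1) by (simp flip: image_mset_mset_set add: multiset.map_comp comp_def)
    also have "\<dots> \<subseteq># mset (map (assoc_class H) vs)"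
      unfolding idx using \<sigma>(2) by (intro image_mset_subseteq_mono subset_imp_msubset_mset_set) auto
    finally show "\<exists>M N. factors_as H a M \<and> factors_as H b N \<and> M \<subseteq># N"
      unfolding factors_as_def using * by blast
  qed
next
  assume "\<exists>M N. factors_as H a M \<and> factors_as H b N \<and> M \<subseteq># N"
  then obtain M N where MN: "factors_as H a M" "factors_as H b N" "M \<subseteq># N"
    by blast
  obtain e us a' where e: "e \<in> isos H" "set us \<subseteq> atoms H" "is_product H us a'"
     "tgt H e = src H a'" "a = e \<cdot> a'" "M = mset (map (assoc_class H) us)"
    using MN(1) unfolding factors_as_def by blast
  obtain h vs b' where h: "h \<in> isos H" "set vs \<subseteq> atoms H" "is_product H vs b'" "tgt H h = src H b'"
     "b = h \<cdot> b'" "N = mset (map (assoc_class H) vs)"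
    using MN(2) unfolding factors_as_def by blast
  have sub: "mset (map (assoc_class H) us) \<subseteq># mset (map (assoc_class H) vs)"
    using MN(3) e h by simp
  \<comment> \<open>\<open>L\<close> lists the classes of \<open>vs\<close> left unmatched.
    Appending it makes both sides equal as multisets, so a permutation exists, and its restriction
    to the first \<open>length us\<close> indices is the required injection.\<close>
  obtain L where L: "mset L = mset (map (assoc_class H) vs) - mset (map (assoc_class H) us)"
    using ex_mset by blast
  then have eq: "mset (map (assoc_class H) us @ L) = mset (map (assoc_class H) vs)"
    using sub by simp
  then obtain \<sigma> where \<sigma>: "\<sigma> permutes {..<length (map (assoc_class H) vs)}"
    "permute_list \<sigma> (map (assoc_class H) vs) = map (assoc_class H) us @ L"
    by (rule mset_eq_permutation)
  have le: "length us \<le> length vs"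
    using mset_eq_length [OF eq] by simp
  have "inj_on \<sigma> {..<length us}"
    using permutes_inj \<sigma>(1) inj_on_subset by blast
  moreover have \<sigma>lt: "\<sigma> i < length vs" if "i < length us" for i
    using permutes_in_image [OF \<sigma>(1), of i] that le by simp
  moreover have "associated H (us ! i) (vs ! \<sigma> i)" if "i < length us" for i
  proof -
    have "assoc_class H (us ! i) = permute_list \<sigma> (map (assoc_class H) vs) ! i"
      using that by (simp add: \<sigma>(2) nth_append)
    also have "\<dots> = assoc_class H (vs ! \<sigma> i)"
      using \<sigma>(1) that le \<sigma>lt by (subst permute_list_nth) auto
    finally show ?thesis
      using assoc_class_eqD that e(2) by (meson atoms_Arr nth_mem subsetD)
  qed
  ultimately show "pdvd H a b"
    unfolding pdvd_def using e h le
    by (intro bexI [of _ e] bexI [of _ h] exI [of _ us] exI [of _ vs] exI [of _ a'] exI [of _ b']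
        exI [of _ \<sigma>]) auto
qed

end

section \<open>Consequences of cancellation\<close>

locale cancellative_small_category = small_category +
  assumes canc: "cancellative H"
begin

text \<open>The arrow \<open>c = b \<cdot> d\<close> is a right inverse of \<open>a\<close>.
  Cancelling \<open>a\<close> on the left in \<open>a \<cdot> (c \<cdot> a) = a\<close> shows that
  it is a left inverse too.\<close>

lemma isos_factor_left:
  assumes "a \<in> Arr H" "b \<in> Arr H" "tgt H a = src H b" "a \<cdot> b \<in> isos H"
  shows "a \<in> isos H"
proof -
  obtain d where d: "d \<in> isos H" "tgt H (a \<cdot> b) = src H d" "tgt H d = src H (a \<cdot> b)"
    "(a \<cdot> b) \<cdot> d = ident H (src H (a \<cdot> b))"
    using isosE [OF assms(4)] by metis
  define c where "c = b \<cdot> d"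
  have c: "c \<in> Arr H" "tgt H a = src H c" "tgt H c = src H a" "a \<cdot> c = ident H (src H a)"
    using d assms unfolding c_def by auto
  have "a \<cdot> (c \<cdot> a) = a \<cdot> ident H (tgt H a)"
    using cmp_assoc [of a c a] c assms by simp
  then have "c \<cdot> a = ident H (tgt H a)"
    using canc c assms unfolding cancellative_def by (metis cmp_Arr src_cmp ident_Arr tgt_Obj src_ident)
  then show ?thesis unfolding isos_def using c assms by auto
qed

text \<open>A nonempty factorization of a unit would begin with an atom that is a left factor of a
  unit, hence itself a unit.\<close>

lemma factors_as_iso_iff:
  assumes "factors_as H a M"
  shows "a \<in> isos H \<longleftrightarrow> M = {#}"
proof
  assume a: "a \<in> isos H"
  show "M = {#}"
  proof (rule ccontr)
    assume "M \<noteq> {#}"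
    then obtain us where us: "us \<noteq> []" "set us \<subseteq> atoms H" "is_product H us a"
      using factors_as_nonempty [OF assms] by blast
    then obtain u vs b where "u \<in> atoms H" "is_product H vs b" "tgt H u = src H b" "a = u \<cdot> b"
      by (cases us) (auto simp: is_product_Cons_iff)
    then have "u \<in> isos H"
      using isos_factor_left [of u b] a is_product_Arr by auto
    then show False using \<open>u \<in> atoms H\<close> by simp
  qed
next
  assume "M = {#}"
  then obtain e x where "e \<in> isos H" "x \<in> Obj H" "tgt H e = src H (ident H x)"
    "a = e \<cdot> ident H x"
    using assms unfolding factors_as_def by (auto simp: is_product_Nil_iff)
  then show "a \<in> isos H"
    using isos_cmp ident_isos by metis
qed

text \<open>If \<open>q = u \<cdot> b\<close> with \<open>u\<close> the first atom of a
  factorization, then \<open>b\<close> is a unit because \<open>q\<close> is an atom, and a unit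
  leaves no room for further atoms.\<close>

lemma atom_factors_as:
  assumes q: "q \<in> atoms H" and f: "factors_as H q M"
  shows "M = {#assoc_class H q#}"
proof -
  have "M \<noteq> {#}" using q factors_as_iso_iff [OF f] by simp
  then obtain us where us: "us \<noteq> []" "set us \<subseteq> atoms H" "is_product H us q"
    "M = mset (map (assoc_class H) us)"
    using factors_as_nonempty [OF f] by blast
  then obtain u vs b where u: "us = u # vs" "u \<in> atoms H" "set vs \<subseteq> atoms H" "is_product H vs b"
    "tgt H u = src H b" "q = u \<cdot> b"
    by (cases us) (auto simp: is_product_Cons_iff)
  have b: "b \<in> Arr H" using is_product_Arr u by blast
  then have "b \<in> isos H"
    using q u atoms_cmpD [of u b] by simp
  then have "vs = []"
    using factors_as_iso_iff [OF factors_asI [OF u(3,4)]] by simp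
  then show ?thesis
    using us u b \<open>b \<in> isos H\<close> by simp
qed

text \<open>The multiset of an atom is a singleton, so inclusion turns into membership.\<close>

lemma pdvd_atom_iff:
  assumes "q \<in> atoms H"
  shows "pdvd H q b \<longleftrightarrow> (\<exists>N. factors_as H b N \<and> assoc_class H q \<in># N)"
proof -
  have "factors_as H q M \<longleftrightarrow> M = {#assoc_class H q#}" for M
    using atom_factors_as factors_as_atom assms by blast
  then show ?thesis by (simp add: pdvd_iff)
qed

text \<open>The definition speaks of nonempty lists without a leading unit. For non-units
  \<open>factors_as_nonempty\<close> provides such lists; units have only the empty
  multiset.\<close>

lemma permutably_factorial_iff:
  "permutably_factorial H \<longleftrightarrow>
     atomic H \<and> (\<forall>a M N. factors_as H a M \<and> factors_as H a N \<longrightarrow> M = N)"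
proof -
  have perm: "(length us = length vs \<and>
        (\<exists>\<sigma>. \<sigma> permutes {..<length us} \<and> (\<forall>i<length us. associated H (us ! i) (vs ! \<sigma> i))))
      \<longleftrightarrow> mset (map (assoc_class H) us) = mset (map (assoc_class H) vs)" (is "?L \<longleftrightarrow> ?R")
    if us: "set us \<subseteq> atoms H" for us vs
  proof
    assume ?L
    then obtain \<sigma> where len: "length us = length vs" and \<sigma>: "\<sigma> permutes {..<length us}"
      "\<forall>i<length us. associated H (us ! i) (vs ! \<sigma> i)" by blast
    have "\<sigma> i < length vs" if "i < length us" for i
      using permutes_in_image [OF \<sigma>(1), of i] that len by simp
    then have "map (assoc_class H) us = permute_list \<sigma> (map (assoc_class H) vs)"
      using \<sigma> len by (intro nth_equalityI) (auto simp: permute_list_nth intro!: assoc_class_eqI)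
    then show ?R using \<sigma>(1) len by (simp add: mset_permute_list del: mset_map)
  next
    assume eq: ?R
    then obtain \<sigma> where \<sigma>: "\<sigma> permutes {..<length (map (assoc_class H) vs)}"
      "permute_list \<sigma> (map (assoc_class H) vs) = map (assoc_class H) us"
      by (rule mset_eq_permutation)
    have len: "length us = length vs" using mset_eq_length [OF eq] by simp
    have "associated H (us ! i) (vs ! \<sigma> i)" if i: "i < length us" for i
    proof -
      have "\<sigma> i < length vs"
        using permutes_in_image [OF \<sigma>(1), of i] i len by simp
      moreover have "map (assoc_class H) us ! i = permute_list \<sigma> (map (assoc_class H) vs) ! i"
        using \<sigma>(2) by simp
      ultimately have "assoc_class H (us ! i) = assoc_class H (vs ! \<sigma> i)"
        using \<sigma>(1) i len by (simp add: permute_list_nth)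
      then show ?thesis using assoc_class_eqD us i by (meson atoms_Arr nth_mem subsetD)
    qed
    then show ?L using len \<sigma>(1) by auto
  qed
  show ?thesis
  proof (intro iffI conjI allI impI)
    assume pf: "permutably_factorial H"
    then show "atomic H" by (simp add: permutably_factorial_def)
    fix a M N assume f: "factors_as H a M \<and> factors_as H a N"
    show "M = N"
    proof (cases "a \<in> isos H")
      case True
      then show ?thesis using f factors_as_iso_iff by blast
    next
      case False
      then have "M \<noteq> {#}" "N \<noteq> {#}" using f factors_as_iso_iff by blast+
      obtain us where us: "us \<noteq> []" "set us \<subseteq> atoms H" "is_product H us a"
        "M = mset (map (assoc_class H) us)"
        using factors_as_nonempty f \<open>M \<noteq> {#}\<close> by blast
      obtain vs where vs: "vs \<noteq> []" "set vs \<subseteq> atoms H" "is_product H vs a"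
        "N = mset (map (assoc_class H) vs)"
        using factors_as_nonempty f \<open>N \<noteq> {#}\<close> by blast
      show ?thesis
        unfolding us(4) vs(4) perm [OF us(2), symmetric]
        using pf us vs unfolding permutably_factorial_def by blast
    qed
  next
    assume *: "atomic H \<and> (\<forall>a M N. factors_as H a M \<and> factors_as H a N \<longrightarrow> M = N)"
    show "permutably_factorial H"
      unfolding permutably_factorial_def
    proof (rule conjI)
      show "atomic H" using * by blast
      show "\<forall>us vs a. us \<noteq> [] \<and> vs \<noteq> [] \<and> set us \<subseteq> atoms H \<and> set vs \<subseteq> atoms H \<and>
          is_product H us a \<and> is_product H vs a \<longrightarrow> length us = length vs \<and>
          (\<exists>\<sigma>. \<sigma> permutes {..<length us} \<and> (\<forall>i<length us. associated H (us ! i) (vs ! \<sigma> i)))"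
      proof (intro allI impI, elim conjE)
        fix us vs a assume "set us \<subseteq> atoms H" "set vs \<subseteq> atoms H" "is_product H us a" "is_product H vs a"
        then show "length us = length vs \<and>
          (\<exists>\<sigma>. \<sigma> permutes {..<length us} \<and> (\<forall>i<length us. associated H (us ! i) (vs ! \<sigma> i)))"
          unfolding perm [OF \<open>set us \<subseteq> atoms H\<close>] using * factors_asI by blast
      qed
    qed
  qed
qed

section \<open>The omega-invariants\<close>

lemma iso_not_pdvd: "\<lbrakk>q \<in> atoms H; e \<in> isos H\<rbrakk> \<Longrightarrow> \<not> pdvd H q e"
  by (auto simp: pdvd_atom_iff factors_as_iso_iff)

text \<open>An empty subproduct is an identity, which no atom divides. So a subproduct of length at
  most 1 that \<open>q\<close> divides is a single factor.\<close>

lemma omega_bound_one_iff: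
  assumes "q \<in> atoms H"
  shows "omega_bound H A a q 1 \<longleftrightarrow>
    (\<forall>as. as \<noteq> [] \<and> set as \<subseteq> A \<and> is_product H as a \<and> pdvd H q a \<longrightarrow> (\<exists>c\<in>set as. pdvd H q c))"
proof -
  have "(\<exists>k \<sigma> c. enat k \<le> 1 \<and> inj_on \<sigma> {..<k} \<and> \<sigma> ` {..<k} \<subseteq> {..<length as} \<and>
           is_product H (map (\<lambda>i. as ! \<sigma> i) [0..<k]) c \<and> pdvd H q c) \<longleftrightarrow> (\<exists>c\<in>set as. pdvd H q c)"
    (is "?L \<longleftrightarrow> ?R") if "is_product H as a" for as :: "'b list"
  proof
    assume ?L
    then obtain k \<sigma> c where k: "enat k \<le> 1" "\<sigma> ` {..<k} \<subseteq> {..<length as}"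
      "is_product H (map (\<lambda>i. as ! \<sigma> i) [0..<k]) c" "pdvd H q c" by blast
    have "k = 0 \<or> k = 1" using k(1) by (auto simp: one_enat_def)
    moreover have "k \<noteq> 0"
    proof
      assume "k = 0"
      then have "c \<in> isos H" using k(3) by (auto simp: is_product_Nil_iff)
      then show False using k(4) iso_not_pdvd [OF assms] by blast
    qed
    ultimately have "c = as ! \<sigma> 0" "\<sigma> 0 < length as"
      using k by (auto simp: is_product_single_iff)
    then show ?R using k by auto
  next
    assume ?R
    then obtain j where j: "j < length as" "pdvd H q (as ! j)" by (auto simp: in_set_conv_nth)
    then have "as ! j \<in> Arr H" using is_product_set [OF that] by auto
    then show ?L
      \<comment> \<open>The constant map is injective on the one-element domain.\<close>
      using j by (intro exI [of _ 1] exI [of _ "\<lambda>_. j"] exI [of _ "as ! j"])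
        (auto simp: one_enat_def is_product_single_iff inj_on_def)
  qed
  then show ?thesis unfolding omega_bound_def by blast
qed

text \<open>The one-term factorization of \<open>q\<close> violates the bound 0, which admits only
  the empty subproduct. \<open>A\<close> will be the set of atoms or of all arrows.\<close>

lemma not_omega_bound_zero:
  assumes "q \<in> atoms H" "q \<in> A"
  shows "\<not> omega_bound H A q q 0"
proof
  assume "omega_bound H A q q 0"
  moreover have "is_product H [q] q" "pdvd H q q"
    using assms factors_as_atom unfolding pdvd_iff by (auto simp: is_product_single_iff)
  ultimately obtain k \<sigma> c where k: "enat k \<le> 0" "pdvd H q c"
      "is_product H (map (\<lambda>i. [q] ! \<sigma> i) [0..<k]) c"
    using assms unfolding omega_bound_def by (elim allE [of _ "[q]"]) auto
  then have "k = 0" by (simp add: zero_enat_def)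
  then have "c \<in> isos H" using k(3) by (auto simp: is_product_Nil_iff)
  then show False using k(2) iso_not_pdvd [OF assms(1)] by blast
qed

end

lemma omega_bound_mono: "\<lbrakk>omega_bound H A a b M; M \<le> N\<rbrakk> \<Longrightarrow> omega_bound H A a b N"
  unfolding omega_bound_def by (meson order_trans)

lemma omega_bound_infinity: "omega_bound H A a b \<infinity>"
  unfolding omega_bound_def
proof (intro allI impI)
  fix as assume "as \<noteq> [] \<and> set as \<subseteq> A \<and> is_product H as a \<and> pdvd H b a"
  then show "\<exists>k \<sigma> c. enat k \<le> \<infinity> \<and> inj_on \<sigma> {..<k} \<and> \<sigma> ` {..<k} \<subseteq> {..<length as} \<and>
      is_product H (map (\<lambda>i. as ! \<sigma> i) [0..<k]) c \<and> pdvd H b c"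
    by (intro exI [of _ "length as"] exI [of _ id] exI [of _ a]) (auto simp: map_nth)
qed

text \<open>The admissible bounds include \<open>\<infinity>\<close> and are closed upwards, so the
  least one exists and everything above it is admissible.\<close>

lemma Least_omega_bound_le_iff: "(LEAST N. omega_bound H A a b N) \<le> N \<longleftrightarrow> omega_bound H A a b N"
  by (meson LeastI Least_le omega_bound_infinity omega_bound_mono)

lemma omega_p'_le_iff:
  "omega_p' H \<le> N \<longleftrightarrow> (\<forall>u\<in>atoms H. \<forall>a\<in>Arr H. omega_bound H (Arr H) a u N)"
  by (simp add: omega_p'_def omega_p'_elt_def omega_p'_at_def SUP_le_iff Least_omega_bound_le_iff)

lemma omega_p_le_iff:
  "omega_p H \<le> N \<longleftrightarrow> (\<forall>u\<in>atoms H. \<forall>a\<in>Arr H. omega_bound H (atoms H) a u N)"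
  by (simp add: omega_p_def omega_p_elt_def omega_p_at_def SUP_le_iff Least_omega_bound_le_iff)

context cancellative_small_category
begin

text \<open>An atom \<open>q\<close> rules out the bound 0 at \<open>a = b = q\<close>; without
  atoms the supremum is empty.\<close>

lemma omega_p_eq_0_iff: "omega_p H = 0 \<longleftrightarrow> atoms H = {}"
  using omega_p_le_iff [of H 0] not_omega_bound_zero [of _ "atoms H"] atoms_Arr by auto

lemma omega_p'_eq_0_iff: "omega_p' H = 0 \<longleftrightarrow> atoms H = {}"
  using omega_p'_le_iff [of H 0] not_omega_bound_zero [of _ "Arr H"] atoms_Arr by auto

section \<open>The two implications\<close>

text \<open>The bound is applied to the two-term list \<open>[a, b]\<close>. Its entries are
  arbitrary arrows, hence the primed invariant.\<close>

lemma atom_almost_prime_like: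
  assumes "omega_p' H \<le> 1" "q \<in> atoms H"
  shows "almost_prime_like H q"
  unfolding almost_prime_like_def
proof (intro conjI ballI impI; (elim conjE)?)
  show "q \<in> Arr H" "q \<notin> isos H" using assms(2) by simp_all
  fix a b assume ab: "a \<in> Arr H" "b \<in> Arr H" "tgt H a = src H b" "pdvd H q (a \<cdot> b)"
  have "is_product H [a, b] (a \<cdot> b)"
    using ab by (auto simp: is_product_Cons_iff [of a] is_product_single_iff)
  moreover have "omega_bound H (Arr H) (a \<cdot> b) q 1"
    using assms ab cmp_Arr unfolding omega_p'_le_iff by blast
  ultimately have "\<exists>c\<in>set [a, b]. pdvd H q c"
    unfolding omega_bound_one_iff [OF assms(2)] using ab by (elim allE [of _ "[a, b]"]) auto
  then show "pdvd H q a \<or> pdvd H q b" by simp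
qed

text \<open>Two multisets of \<open>a\<close> are compared class by class. A class occurring in one
  of them is that of an atom \<open>q\<close>, and both multiplicities lie in the singleton
  \<open>V_values H q a\<close>.\<close>

lemma permutably_factorial_if_prime_like:
  assumes "atomic H" and prime: "\<And>q. q \<in> atoms H \<Longrightarrow> prime_like H q"
  shows "permutably_factorial H"
  unfolding permutably_factorial_iff
proof (intro conjI allI impI multiset_eqI; (elim conjE)?)
  fix a M N C assume f: "factors_as H a M" "factors_as H a N"
  show "count M C = count N C"
  proof (cases "C \<in># M + N")
    case True
    then obtain q where q: "q \<in> atoms H" "C = assoc_class H q"
      using factors_as_classes f by (metis union_iff)
    then have "card (V_values H q a) = 1"
      using prime factors_as_Arr f by (simp add: prime_like_def)
    then obtain n where "V_values H q a = {n}" by (auto simp: card_1_singleton_iff)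
    then show ?thesis
      using V_values_eq [of q a] q f by (metis atoms_Arr imageI mem_Collect_eq singletonD)
  next
    case False
    then show ?thesis by (simp add: not_in_iff)
  qed
qed (rule assms(1))

text \<open>By uniqueness the multiset of a product is the sum of those of its factors, so a class
  occurring in it occurs in one of the summands.\<close>

lemma permutably_factorial_pdvd_factor:
  assumes pf: "permutably_factorial H" and q: "q \<in> atoms H"
    and "is_product H as a" "pdvd H q a"
  shows "\<exists>c\<in>set as. pdvd H q c"
  using assms(3,4)
proof (induction rule: is_product.induct)
  case (Nil x)
  then show ?case using iso_not_pdvd q by simp
next
  case (Cons u us a)
  have "a \<in> Arr H" using is_product_Arr Cons by blast
  then obtain M N where MN: "factors_as H u M" "factors_as H a N"
    using factors_as_exists pf Cons permutably_factorial_def by metis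
  then have "factors_as H (u \<cdot> a) (M + N)"
    using Cons by (intro factors_as_cmp) auto
  then have "assoc_class H q \<in># M + N"
    using Cons.prems pf pdvd_atom_iff [OF q] permutably_factorial_iff by metis
  then have "pdvd H q u \<or> pdvd H q a"
    using MN pdvd_atom_iff [OF q] by auto
  then show ?case using Cons.IH by auto
qed

text \<open>For \<open>q = a \<cdot> b\<close> with multisets \<open>M\<close> and \<open>N\<close>,
  almost primeness puts \<open>M + N\<close> inside \<open>M\<close> or inside
  \<open>N\<close>.\<close>

lemma permutably_factorial_almost_prime_like_atom:
  assumes pf: "permutably_factorial H" and q: "almost_prime_like H q"
  shows "q \<in> atoms H"
  unfolding atoms_def
proof (intro CollectI conjI ballI impI; (elim conjE)?)
  show "q \<in> Arr H" "q \<notin> isos H" using q by (simp_all add: almost_prime_like_def)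
  fix a b assume ab: "a \<in> Arr H" "b \<in> Arr H" "tgt H a = src H b" "q = a \<cdot> b"
  have uniq: "M = N" if "factors_as H x M" "factors_as H x N" for x M N
    using that pf permutably_factorial_iff by blast
  obtain M N where MN: "factors_as H a M" "factors_as H b N"
    using factors_as_exists pf ab permutably_factorial_def by metis
  then have fq: "factors_as H q (M + N)"
    using ab factors_as_cmp by simp
  then have "pdvd H q (a \<cdot> b)" using pdvd_iff ab by auto
  then have "pdvd H q a \<or> pdvd H q b"
    using q ab unfolding almost_prime_like_def by blast
  then have "M + N \<subseteq># M \<or> M + N \<subseteq># N"
    unfolding pdvd_iff using uniq fq MN by metis
  \<comment> \<open>Comparing sizes, the other summand must be empty, so its element is a
    unit.\<close>
  then have "M = {#} \<or> N = {#}"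
    by (auto dest: size_mset_mono)
  then show "a \<in> isos H \<or> b \<in> isos H" using MN factors_as_iso_iff by blast
qed

lemma permutably_factorial_prime_like:
  assumes pf: "permutably_factorial H" and q: "almost_prime_like H q"
  shows "prime_like H q"
proof -
  have "card (V_values H q a) = 1" if a: "a \<in> Arr H" for a
  proof -
    obtain M where "factors_as H a M"
      using factors_as_exists pf a permutably_factorial_def by metis
    then have "{M. factors_as H a M} = {M}"
      using pf permutably_factorial_iff by auto
    then show ?thesis using V_values_eq q by (simp add: almost_prime_like_def)
  qed
  then show ?thesis
    unfolding prime_like_def using assms permutably_factorial_almost_prime_like_atom by simp
qed

end

theorem proposition5p19:
  fixes H :: "('o, 'm) small_cat"
  assumes "small_category H"
    and "cancellative H"
  shows "permutably_factorial H \<longleftrightarrow>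
    atomic H \<and> omega_p' H = omega_p H \<and> omega_p H \<le> 1 \<and>
    (\<forall>q\<in>Arr H. almost_prime_like H q \<longrightarrow> prime_like H q)"
proof -
  interpret cancellative_small_category H
    using assms by (simp add: cancellative_small_category_def cancellative_small_category_axioms_def)
  show ?thesis
  proof
    assume pf: "permutably_factorial H"
    have "omega_bound H A a q 1" if "q \<in> atoms H" for A a q
      unfolding omega_bound_one_iff [OF that]
      using permutably_factorial_pdvd_factor [OF pf that] by blast
    then have "omega_p' H \<le> 1" "omega_p H \<le> 1"
      unfolding omega_p'_le_iff omega_p_le_iff by blast+
    \<comment> \<open>Each invariant is thus 0 or 1, and both vanish under the same condition,
      namely that there are no atoms.\<close>
    moreover have "x = 1" if "x \<noteq> 0" "x \<le> 1" for x :: enat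
      using that by (cases x) (auto simp: one_enat_def zero_enat_def)
    ultimately have "omega_p' H = omega_p H"
      using omega_p_eq_0_iff omega_p'_eq_0_iff by metis
    then show "atomic H \<and> omega_p' H = omega_p H \<and> omega_p H \<le> 1 \<and>
        (\<forall>q\<in>Arr H. almost_prime_like H q \<longrightarrow> prime_like H q)"
      using pf \<open>omega_p H \<le> 1\<close> permutably_factorial_prime_like
      by (simp add: permutably_factorial_def)
  next
    assume "atomic H \<and> omega_p' H = omega_p H \<and> omega_p H \<le> 1 \<and>
        (\<forall>q\<in>Arr H. almost_prime_like H q \<longrightarrow> prime_like H q)"
    then show "permutably_factorial H"
      \<comment> \<open>The equality of the invariants carries the bound 1 over to
        \<open>omega_p' H\<close>. Atoms are then almost prime-like, hence prime-like by
        assumption.\<close>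
      using atom_almost_prime_like by (intro permutably_factorial_if_prime_like) auto
  qed
qed

end
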